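(* Let $H$ be a finite, connected hypergraph with oriented line graph $H_L^o$. For each $l$ there is a one-to-one correspondence between prime cycles of length $l$ in $H$ and admissible prime cycles of length $l$ in $H_L^o$. In particular, the generalized Ihara-Selberg zeta function of $H$ can be written as $$\zeta_H(u)=\det(I-uT)^{-1},$$ where $T$ is the Perron-Frobenius operator of $H_L^o$.
   Context: A hypergraph $H=(V,E)$ consists of a set $V$ of hypervertices and a family $E$ of hyperedges, each a nonempty subset of $V$, with union $V$; repeated hyperedges are allowed and count as distinct elements of $E$. $H$ is connected if the bipartite graph on $V\sqcup E$ (with $v$ adjacent to $e$ iff $v\in e$) is connected. A closed path of length $k\ge 1$ in $H$ is a sequence $c=(v_1,e_1,\dots,v_k,e_k,v_1)$ with $v_i\in e_{i-1}\cap e_i$ and $v_i\ne v_{i+1}$ for all $i\in\mathbb Z/k\mathbb Z$. It has hyperedge backtracking if it contains consecutive entries $(e,v,e)$. $c^m$ is $c$ traversed $m$ times; $c$ is tail-less if $c^2$ has no hyperedge backtracking. A primitive cycle is a closed path without hyperedge backtracking, tail-less, and not of the form $b^m$ with $m\ge2$, $b$ a closed path. Prime cycles $\mathfrak p$ are equivalence classes of primitive cycles under cyclic permutation, of length $|\mathfrak p|$. For $u\in\mathbb C$ with $|u|$ sufficiently small, $\zeta_H(u)=\prod_{\mathfrak p}(1-u^{|\mathfrak p|})^{-1}$, the product over all prime cycles of $H$. Oriented line graph: assign a distinct color to each hyperedge. Form the edge-colored multigraph on vertex set $V$ that has, for each hyperedge $e$ and each pair of distinct hypervertices $v,w\in e$,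 an edge joining $v$ and $w$ with the color of $e$; replace each edge by both of its orientations, giving oriented edges $\{v,w\}_e$ (origin $v$, terminus $w$, color that of $e$) for all $e\in E$ and distinct $v,w\in e$. The oriented line graph $H_L^o=(V_L,E_L^o)$ has as vertex set $V_L$ the set of all these oriented edges, and $E_L^o$ is the set of pairs $(a,b)\in V_L\times V_L$ such that the colors of $a$ and $b$ differ and the terminus of $a$ equals the origin of $b$; such a pair is an oriented edge from $a$ to $b$. An admissible path in $H_L^o$ is a sequence of oriented edges in $E_L^o$ each starting where the previous one ends; its length is the number of edges. An admissible prime cycle is an equivalence class, under cyclic permutation, of closed admissible paths of positive length that are not $m$-fold multiples ($m\ge 2$) of another closed admissible path. The Perron-Frobenius operator $T$ acts on the space $C(V_L)$ of complex functions on $V_L$ by $(Tf)(x)=\sum_{e}f(t(e))$, the sum over all oriented edges $e\in E_L^o$ with origin $x$, $t(e)$ being the terminus of $e$. *)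

theory Defs
  imports
    Complex_Main
    "Graph_Theory.Arc_Walk"
    "Graph_Theory.Digraph_Component"
    "Jordan_Normal_Form.Determinant"
begin

section \<open>Hypergraphs\<close>

text \<open>
  The hyperedges form a family: elements of \<open>hedges H\<close> are the names of the hyperedges and
  \<open>ends H e\<close> is the set of hypervertices of \<open>e\<close>. Different names may have the same set of
  hypervertices, which accounts for repeated hyperedges.
\<close>

record ('v, 'e) hypergraph =
  hverts :: "'v set"
  hedges :: "'e set"
  ends :: "'e \<Rightarrow> 'v set"

definition is_hypergraph :: "('v, 'e) hypergraph \<Rightarrow> bool" where
  "is_hypergraph H \<longleftrightarrow>
     (\<forall>e\<in>hedges H. ends H e \<noteq> {} \<and> ends H e \<subseteq> hverts H) \<and>
     (\<Union>e\<in>hedges H. ends H e) = hverts H"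

definition finite_hypergraph :: "('v, 'e) hypergraph \<Rightarrow> bool" where
  "finite_hypergraph H \<longleftrightarrow> is_hypergraph H \<and> finite (hverts H) \<and> finite (hedges H)"

text \<open>
  The bipartite incidence graph. Its arcs all point from hypervertices to hyperedges, but
  \<^const>\<open>Digraph_Component.connected\<close> passes to the symmetric closure, so the direction
  plays no role for connectedness. That predicate is false for the graph without vertices.
\<close>

definition incidence_graph :: "('v, 'e) hypergraph \<Rightarrow> ('v + 'e, 'v \<times> 'e) pre_digraph" where
  "incidence_graph H =
     \<lparr> verts = hverts H <+> hedges H,
       arcs = {(v, e). v \<in> hverts H \<and> e \<in> hedges H \<and> v \<in> ends H e},
       tail = (\<lambda>(v, e). Inl v),
       head = (\<lambda>(v, e). Inr e) \<rparr>"

definition connected_hypergraph :: "('v, 'e) hypergraph \<Rightarrow> bool" where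
  "connected_hypergraph H \<longleftrightarrow> Digraph_Component.connected (incidence_graph H)"


section \<open>Cyclic sequences\<close>

definition seq_power :: "'a list \<Rightarrow> nat \<Rightarrow> 'a list" where
  "seq_power c m = concat (replicate m c)"

definition cyclic_perm_rel :: "'a list set \<Rightarrow> ('a list \<times> 'a list) set" where
  "cyclic_perm_rel A = {(c, d). c \<in> A \<and> d \<in> A \<and> (\<exists>n. d = rotate n c)}"

text \<open>The common length of all members of a class under cyclic permutation.\<close>

definition cycle_length :: "'a list set \<Rightarrow> nat" where
  "cycle_length p = the_elem (length ` p)"


section \<open>Prime cycles of a hypergraph\<close>

text \<open>
  The closed path \<open>(v\<^sub>1, e\<^sub>1, \<dots>, v\<^sub>k, e\<^sub>k, v\<^sub>1)\<close> is represented by the list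
  \<open>[(v\<^sub>1, e\<^sub>1), \<dots>, (v\<^sub>k, e\<^sub>k)]\<close>; the final \<open>v\<^sub>1\<close> is implicit.
\<close>

definition closed_path :: "('v, 'e) hypergraph \<Rightarrow> ('v \<times> 'e) list \<Rightarrow> bool" where
  "closed_path H c \<longleftrightarrow>
     c \<noteq> [] \<and>
     (\<forall>i < length c.
        let (v, e) = c ! i; (v', e') = c ! (Suc i mod length c) in
          v \<in> hverts H \<and> e \<in> hedges H \<and> v' \<in> ends H e \<inter> ends H e' \<and> v \<noteq> v')"

text \<open>
  Consecutive entries \<open>(e, v, e)\<close> of the path: the comparison does not wrap around from the
  last hyperedge to the first one, which is why being tail-less is a separate condition.
\<close>

definition hyperedge_backtracking :: "('v \<times> 'e) list \<Rightarrow> bool" where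
  "hyperedge_backtracking c \<longleftrightarrow> (\<exists>i. Suc i < length c \<and> snd (c ! i) = snd (c ! Suc i))"

definition tailless :: "('v \<times> 'e) list \<Rightarrow> bool" where
  "tailless c \<longleftrightarrow> \<not> hyperedge_backtracking (seq_power c 2)"

definition primitive_cycle :: "('v, 'e) hypergraph \<Rightarrow> ('v \<times> 'e) list \<Rightarrow> bool" where
  "primitive_cycle H c \<longleftrightarrow>
     closed_path H c \<and> \<not> hyperedge_backtracking c \<and> tailless c \<and>
     \<not> (\<exists>b m. closed_path H b \<and> m \<ge> 2 \<and> c = seq_power b m)"

definition prime_cycles :: "('v, 'e) hypergraph \<Rightarrow> ('v \<times> 'e) list set set" where
  "prime_cycles H = {c. primitive_cycle H c} // cyclic_perm_rel {c. primitive_cycle H c}"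

text \<open>
  The product over all prime cycles is unordered: the limit of the finite subproducts along the
  filter of finite sets of prime cycles. If the limit does not exist, the value of
  \<open>hypergraph_zeta\<close> is unspecified.
\<close>

definition zeta_product :: "('v, 'e) hypergraph \<Rightarrow> complex \<Rightarrow> ('v \<times> 'e) list set set \<Rightarrow> complex" where
  "zeta_product H u F = (\<Prod>p\<in>F. inverse (1 - u ^ cycle_length p))"

definition zeta_converges :: "('v, 'e) hypergraph \<Rightarrow> complex \<Rightarrow> bool" where
  "zeta_converges H u \<longleftrightarrow>
     (\<exists>z. z \<noteq> 0 \<and> (zeta_product H u \<longlongrightarrow> z) (finite_subsets_at_top (prime_cycles H)))"

definition hypergraph_zeta :: "('v, 'e) hypergraph \<Rightarrow> complex \<Rightarrow> complex" where
  "hypergraph_zeta H u = Lim (finite_subsets_at_top (prime_cycles H)) (zeta_product H u)"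


section \<open>The oriented line graph\<close>

text \<open>
  The oriented edge \<open>{v, w}\<^sub>e\<close> is the triple \<open>(v, e, w)\<close>; the hyperedge \<open>e\<close> serves as its own color.
\<close>

type_synonym ('v, 'e) oedge = "'v \<times> 'e \<times> 'v"

definition origin :: "('v, 'e) oedge \<Rightarrow> 'v" where
  "origin = (\<lambda>(v, e, w). v)"

definition terminus :: "('v, 'e) oedge \<Rightarrow> 'v" where
  "terminus = (\<lambda>(v, e, w). w)"

definition color :: "('v, 'e) oedge \<Rightarrow> 'e" where
  "color = (\<lambda>(v, e, w). e)"

definition oriented_edges :: "('v, 'e) hypergraph \<Rightarrow> ('v, 'e) oedge set" where
  "oriented_edges H = {(v, e, w). e \<in> hedges H \<and> v \<in> ends H e \<and> w \<in> ends H e \<and> v \<noteq> w}"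

definition oriented_line_graph ::
  "('v, 'e) hypergraph \<Rightarrow> (('v, 'e) oedge, ('v, 'e) oedge \<times> ('v, 'e) oedge) pre_digraph" where
  "oriented_line_graph H =
     \<lparr> verts = oriented_edges H,
       arcs = {(a, b). a \<in> oriented_edges H \<and> b \<in> oriented_edges H \<and>
                       color a \<noteq> color b \<and> terminus a = origin b},
       tail = fst,
       head = snd \<rparr>"

definition closed_admissible :: "('a, 'b) pre_digraph \<Rightarrow> 'b list \<Rightarrow> bool" where
  "closed_admissible G c \<longleftrightarrow> c \<noteq> [] \<and> (\<exists>a. pre_digraph.awalk G a c a)"

definition admissible_primitive :: "('a, 'b) pre_digraph \<Rightarrow> 'b list \<Rightarrow> bool" where
  "admissible_primitive G c \<longleftrightarrow>
     closed_admissible G c \<and>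
     \<not> (\<exists>b m. closed_admissible G b \<and> m \<ge> 2 \<and> c = seq_power b m)"

definition admissible_prime_cycles :: "('a, 'b) pre_digraph \<Rightarrow> 'b list set set" where
  "admissible_prime_cycles G =
     {c. admissible_primitive G c} // cyclic_perm_rel {c. admissible_primitive G c}"


section \<open>The Perron-Frobenius operator\<close>

definition perron_frobenius ::
  "('a, 'b) pre_digraph \<Rightarrow> ('a \<Rightarrow> complex) \<Rightarrow> ('a \<Rightarrow> complex)" where
  "perron_frobenius G f = (\<lambda>x. \<Sum>e\<in>out_arcs G x. f (head G e))"

text \<open>
  The matrix of an operator on the complex functions on a finite set, enumerated without
  repetition by \<open>xs\<close>, with respect to the basis of indicator functions of the points of that set.
\<close>

definition operator_matrix ::
  "'a list \<Rightarrow> (('a \<Rightarrow> complex) \<Rightarrow> ('a \<Rightarrow> complex)) \<Rightarrow> complex mat" where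
  "operator_matrix xs A =
     mat (length xs) (length xs) (\<lambda>(i, j). A (\<lambda>x. if x = xs ! j then 1 else 0) (xs ! i))"

end

theory Submission
  imports
    Defs
    "Jordan_Normal_Form.Schur_Decomposition"
    "HOL-Analysis.Complex_Transcendental"
    "HOL-Analysis.Infinite_Sum"
begin

text \<open>
  Prime cycles of \<open>H\<close> and admissible prime cycles of its oriented line graph \<open>L\<close> are two instances
  of one notion. Fix a relation \<open>R\<close> on a set of letters. The nonempty words whose cyclically
  consecutive letters are related by \<open>R\<close> (\<open>closed_chains R\<close>) are closed under rotation and under
  taking powers and roots; a \<^emph>\<open>necklace\<close> is a rotation class of words among them that are not
  proper powers. For \<open>H\<close> the letters are the pairs (hypervertex, hyperedge), and \<open>R\<close> combines the
  step condition of a closed path with the condition that the hyperedge changes; asking for the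
  change cyclically is the same as excluding backtracking and tails. For \<open>L\<close> the letters are the
  arcs, and \<open>R\<close> says that the head of one arc is the tail of the next.

  Sending the closed path with entries \<open>(v\<^sub>i, e\<^sub>i)\<close> to the closed walk through the oriented edges
  \<open>(v\<^sub>i, e\<^sub>i, v\<^sub>i\<^sub>+\<^sub>1)\<close> determines each letter of the image by a window of consecutive letters of the
  path, and so does the inverse map. Such sliding block codes commute with rotations and with
  powers, so they map necklaces bijectively to necklaces and preserve the length
  (\<open>bij_betw_prime_cycles\<close>).

  For the zeta function take logarithms. Every nonempty word is a power \<open>b\<^sup>m\<close> of a unique
  primitive word, and a primitive word of length \<open>d\<close> has exactly \<open>d\<close>
  rotations. Therefore, with the closed chains \<open>c\<close> on one side and the necklaces
  \<open>p\<close> on the other, the sum of \<open>u\<^bsup>|c|\<^esup> / |c|\<close> over all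
  \<open>c\<close> equals the sum of \<open>u\<^bsup>m |p|\<^esup> / m\<close> over all
  \<open>p\<close> and \<open>m \<ge> 1\<close>, which is the sum of \<open>- log (1 -
  u\<^bsup>|p|\<^esup>)\<close> over all \<open>p\<close> (\<open>has_sum_log_necklaces\<close>). In
  a finite digraph with transfer matrix \<open>A\<close> there are \<open>tr(A\<^sup>l)\<close>
  closed chains of length \<open>l\<close>, so with the eigenvalues \<open>\<lambda>\<^sub>i\<close>
  of \<open>A\<close> the first sum is \<open>\<Sum>\<^bsub>l \<ge> 1\<^esub> tr(A\<^sup>l)
  u\<^sup>l / l = \<Sum>\<^sub>i - log (1 - u \<lambda>\<^sub>i)\<close>, whose exponential is
  \<open>1 / det (1 - u A)\<close> (\<open>exp_log_zeta_eq_inverse_det\<close>). All series converge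
  absolutely if both \<open>|u|\<close> and \<open>|u|\<close> times the number of arcs are below 1,
  because there are at most \<open>N\<^sup>l\<close> words of length \<open>l\<close> over
  \<open>N\<close> arcs, and because no eigenvalue exceeds the largest row sum of \<open>A\<close>
  in absolute value.
\<close>


section \<open>Powers and rotations of words\<close>

text \<open>
  Reading a word cyclically turns rotations into shifts and makes a word and its powers
  indistinguishable, which reduces statements about rotations, powers and cyclically consecutive
  letters to statements about sequences.
\<close>

definition periodic_ext :: "'a list \<Rightarrow> nat \<Rightarrow> 'a" where
  "periodic_ext c i = c ! (i mod length c)"

text \<open>
  The roots that are excluded range over all words. For words in a class that contains the roots
  of its members this agrees with excluding only roots in that class; see \<open>primitive_chains_alt\<close>.
\<close>

definition primitive_word :: "'a list \<Rightarrow> bool" where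
  "primitive_word c \<longleftrightarrow> c \<noteq> [] \<and> \<not> (\<exists>b m. m \<ge> 2 \<and> c = seq_power b m)"

lemma length_seq_power [simp]: "length (seq_power c m) = m * length c"
  by (induction m) (auto simp: seq_power_def)

lemma seq_power_1 [simp]: "seq_power c (Suc 0) = c"
  by (simp add: seq_power_def)

lemma seq_power_mult: "seq_power (seq_power c m) n = seq_power c (n * m)"
  by (induction n) (simp_all add: seq_power_def replicate_add)

lemma nth_seq_power: "i < m * length c \<Longrightarrow> seq_power c m ! i = periodic_ext c i"
proof (induction m arbitrary: i)
  case (Suc m)
  show ?case
  proof (cases "i < length c")
    case True
    then show ?thesis by (simp add: seq_power_def nth_append periodic_ext_def)
  next
    case False
    then have "periodic_ext c i = periodic_ext c (i - length c)"
      by (simp add: periodic_ext_def le_mod_geq)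
    then show ?thesis using False Suc by (simp add: seq_power_def nth_append)
  qed
qed simp

lemma periodic_ext_nth [simp]: "i < length c \<Longrightarrow> periodic_ext c i = c ! i"
  by (simp add: periodic_ext_def)

lemma periodic_ext_add_length: "periodic_ext c (i + k * length c) = periodic_ext c i"
  by (simp add: periodic_ext_def)

lemma periodic_ext_seq_power:
  assumes "c \<noteq> []" "m > 0"
  shows "periodic_ext (seq_power c m) i = periodic_ext c i"
proof -
  have "periodic_ext (seq_power c m) i = seq_power c m ! (i mod (m * length c))"
    by (simp add: periodic_ext_def)
  also have "\<dots> = periodic_ext c (i mod (m * length c))"
    using assms by (intro nth_seq_power) simp
  also have "\<dots> = periodic_ext c i"
    by (simp add: periodic_ext_def mod_mod_cancel)
  finally show ?thesis .
qed

lemma periodic_ext_rotate: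
  assumes "c \<noteq> []"
  shows "periodic_ext (rotate n c) i = periodic_ext c (n + i)"
  using assms by (simp add: periodic_ext_def nth_rotate mod_add_right_eq)

lemma periodic_ext_eqI:
  assumes "length c = length d" "\<And>i. periodic_ext c i = periodic_ext d i"
  shows "c = d"
  using assms by (intro nth_equalityI) (auto, metis periodic_ext_nth)

lemma primitive_root_exists:
  assumes "c \<noteq> []"
  shows "\<exists>b m. m \<ge> 1 \<and> primitive_word b \<and> c = seq_power b m"
  using assms
proof (induction c rule: length_induct)
  case (1 c)
  show ?case
  proof (cases "primitive_word c")
    case True
    then show ?thesis by (metis One_nat_def order_refl seq_power_1)
  next
    case False
    with 1 obtain b m where bm: "m \<ge> 2" "c = seq_power b m"
      by (auto simp: primitive_word_def)
    with 1 have "b \<noteq> []" by (auto simp: seq_power_def)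
    moreover from this bm have "length b < length c" by simp
    ultimately obtain a k where "k \<ge> 1" "primitive_word a" "b = seq_power a k"
      using 1 by blast
    then show ?thesis
      using bm by (intro exI[of _ a] exI[of _ "m * k"]) (auto simp: seq_power_mult)
  qed
qed

text \<open>
  Let \<open>f\<close> be the common periodic sequence. It has both lengths as periods, so after either of the
  two words the sequence starts again with the other one: both products are the prefix of \<open>f\<close> of
  length \<open>|a| + |b|\<close>.
\<close>

lemma periodic_ext_eq_imp_comm:
  assumes "\<And>i. periodic_ext a i = periodic_ext b i"
  shows "a @ b = b @ a"
proof (cases "a = [] \<or> b = []")
  case False
  have *: "(x @ y) ! i = periodic_ext x i"
    if "\<And>i. periodic_ext x i = periodic_ext y i" "i < length x + length y" for x y :: "'a list" and i
  proof (cases "i < length x")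
    case False
    then have "(x @ y) ! i = periodic_ext y (i - length x)"
      using that by (simp add: nth_append)
    also have "\<dots> = periodic_ext x (i - length x)"
      by (simp only: that(1))
    also have "\<dots> = periodic_ext x i"
      using False periodic_ext_add_length[of x "i - length x" 1] by simp
    finally show ?thesis .
  qed (simp add: nth_append)
  show ?thesis
    using assms by (intro nth_equalityI) (auto simp: * )
qed auto

text \<open>
  Commuting words are powers of a common word.
\<close>

lemma primitive_comm_imp_eq:
  assumes "primitive_word a" "primitive_word b" "a @ b = b @ a"
  shows "a = b"
proof -
  obtain i j z where z: "a = seq_power z i" "b = seq_power z j"
    using comm_append_are_replicate[OF assms(3)] by (auto simp: seq_power_def)
  have "i \<noteq> 0" "j \<noteq> 0" using assms z by (auto simp: primitive_word_def seq_power_def intro!: Nat.gr0I)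
  moreover have "\<not> i \<ge> 2" "\<not> j \<ge> 2" using assms z by (auto simp: primitive_word_def)
  ultimately have "i = 1" "j = 1" by auto
  with z show ?thesis by simp
qed

lemma primitive_root_unique:
  assumes "primitive_word a" "primitive_word b" "seq_power a m = seq_power b n" "m \<ge> 1" "n \<ge> 1"
  shows "a = b" "m = n"
proof -
  have ne: "a \<noteq> []" "b \<noteq> []" using assms by (auto simp: primitive_word_def)
  have "periodic_ext a i = periodic_ext b i" for i
    using periodic_ext_seq_power[of a m i] periodic_ext_seq_power[of b n i] ne assms by simp
  from primitive_comm_imp_eq[OF assms(1,2) periodic_ext_eq_imp_comm[OF this]] show "a = b" .
  with assms(3) have "m * length b = n * length b" by (metis length_seq_power)
  with ne show "m = n" by simp
qed

lemma rotate_seq_power: "rotate n (seq_power b m) = seq_power (rotate n b) m"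
proof (cases "b = [] \<or> m = 0")
  case False
  then have "seq_power b m \<noteq> []"
    by (metis length_0_conv length_seq_power mult_is_0)
  with False show ?thesis
    by (intro periodic_ext_eqI) (simp_all add: periodic_ext_rotate periodic_ext_seq_power)
qed (auto simp: seq_power_def)

lemma rotate_inverse: "rotate (length c - n mod length c) (rotate n c) = c"
proof (cases "c = []")
  case False
  then have "(length c - n mod length c + n) mod length c = 0"
    by (metis add.commute le_add_diff_inverse2 mod_add_right_eq mod_le_divisor mod_self 
        length_greater_0_conv)
  then show ?thesis by (metis rotate_rotate rotate_id)
qed simp

lemma primitive_word_rotate: "primitive_word (rotate n c) \<longleftrightarrow> primitive_word c"
proof -
  have "primitive_word c" if "primitive_word (rotate n c)" for n and c :: "'a list"
    unfolding primitive_word_def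
  proof safe
    assume "c = []"
    with that show False by (simp add: primitive_word_def)
  next
    fix b m assume "2 \<le> m" "c = seq_power b m"
    with that show False by (auto simp: primitive_word_def rotate_seq_power)
  qed
  then show ?thesis by (metis rotate_inverse)
qed

text \<open>
  Two equal rotations at distance \<open>k\<close> split a rotation of \<open>c\<close> into a prefix of length \<open>k\<close> and a
  nonempty rest that commute. They are then powers of a common word, and so is their product.
\<close>

lemma primitive_word_rotations_distinct:
  assumes "primitive_word c"
  shows "inj_on (\<lambda>n. rotate n c) {..<length c}"
proof (rule linorder_inj_onI)
  fix m n assume mn: "m < n" "m \<in> {..<length c}" "n \<in> {..<length c}"
  show "rotate m c \<noteq> rotate n c"
  proof
    assume "rotate m c = rotate n c"
    moreover have "primitive_word (rotate m c)" using assms by (simp add: primitive_word_rotate)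
    moreover define d k where dk: "d = rotate m c" "k = n - m"
    moreover have "rotate k d = rotate n c"
      using mn by (simp add: dk rotate_rotate)
    ultimately have d: "primitive_word d" "rotate k d = d" "0 < k" "k < length d"
      using mn by auto
    then have "take k d @ drop k d = drop k d @ take k d"
      by (simp add: rotate_drop_take)
    then obtain i j z where z: "take k d = seq_power z i" "drop k d = seq_power z j"
      using comm_append_are_replicate[of "take k d" "drop k d"] unfolding seq_power_def by metis
    have "i \<noteq> 0" "j \<noteq> 0"
      using z d(3,4) by (auto simp: seq_power_def intro!: Nat.gr0I)
    then have "i + j \<ge> 2"
      by simp
    moreover have "d = seq_power z (i + j)"
      using z by (metis append_take_drop_id seq_power_def concat_append replicate_add)
    ultimately show False
      using d(1) unfolding primitive_word_def by blast
  qed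
qed auto

section \<open>Necklaces\<close>

text \<open>
  Stated on the periodic sequence, the condition passes at once between a word, its rotations, its
  powers and its roots. A word of length 1 has to satisfy \<open>R x x\<close>, so irreflexive relations
  exclude it.
\<close>

definition closed_chains :: "('a \<Rightarrow> 'a \<Rightarrow> bool) \<Rightarrow> 'a list set" where
  "closed_chains R = {c. c \<noteq> [] \<and> (\<forall>i. R (periodic_ext c i) (periodic_ext c (Suc i)))}"

lemma closed_chains_iff:
  "c \<in> closed_chains R \<longleftrightarrow> c \<noteq> [] \<and> (\<forall>i<length c. R (c ! i) (c ! (Suc i mod length c)))"
proof -
  have "(\<forall>i. R (periodic_ext c i) (periodic_ext c (Suc i))) \<longleftrightarrow>
        (\<forall>i<length c. R (c ! i) (c ! (Suc i mod length c)))" (is "?L = ?R") if "c \<noteq> []"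
  proof
    assume ?R
    show ?L
    proof
      fix i
      have "i mod length c < length c" using that by simp
      with \<open>?R\<close> have "R (c ! (i mod length c)) (c ! (Suc (i mod length c) mod length c))" by blast
      then show "R (periodic_ext c i) (periodic_ext c (Suc i))"
        by (simp add: periodic_ext_def mod_Suc_eq)
    qed
  qed (auto simp: periodic_ext_def, metis mod_less)
  then show ?thesis by (auto simp: closed_chains_def)
qed

text \<open>
  Backtracking is a condition inside a word, whereas being tail-less also concerns the place where
  the word closes up; likewise for the consistency of a walk and its being closed. This
  separates the two.
\<close>

lemma closed_chains_iff_successively:
  "c \<in> closed_chains R \<longleftrightarrow> c \<noteq> [] \<and> successively R c \<and> R (last c) (hd c)"
proof (cases "c = []")
  case False
  define n where "n = length c - 1"
  have len: "length c = Suc n"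
    using False by (simp add: n_def)
  have "(\<forall>i<length c. R (c ! i) (c ! (Suc i mod length c))) \<longleftrightarrow>
        (\<forall>i<n. R (c ! i) (c ! Suc i)) \<and> R (c ! n) (c ! 0)"
    by (simp add: len All_less_Suc conj_commute cong: conj_cong)
  then show ?thesis
    using False by (simp add: closed_chains_iff successively_conv_nth last_conv_nth hd_conv_nth len)
qed (simp add: closed_chains_def)

lemma seq_power_closed_chains_iff:
  assumes "m > 0"
  shows "seq_power c m \<in> closed_chains R \<longleftrightarrow> c \<in> closed_chains R"
proof (cases "c = []")
  case False
  with assms have "seq_power c m \<noteq> []" by (metis length_0_conv length_seq_power mult_is_0 not_gr0)
  with False assms show ?thesis by (simp add: closed_chains_def periodic_ext_seq_power)
qed (simp add: closed_chains_def seq_power_def)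

lemma rotate_closed_chains: "c \<in> closed_chains R \<Longrightarrow> rotate n c \<in> closed_chains R"
  by (simp add: closed_chains_def periodic_ext_rotate)

definition primitive_chains :: "('a \<Rightarrow> 'a \<Rightarrow> bool) \<Rightarrow> 'a list set" where
  "primitive_chains R = {c \<in> closed_chains R. primitive_word c}"

definition rotation_class :: "'a list \<Rightarrow> 'a list set" where
  "rotation_class c = range (\<lambda>n. rotate n c)"

lemma rotate_primitive_chains: "c \<in> primitive_chains R \<Longrightarrow> rotate n c \<in> primitive_chains R"
  by (simp add: primitive_chains_def rotate_closed_chains primitive_word_rotate)

text \<open>
  A root of a closed chain has the same periodic sequence, hence is a closed chain. This links
  \<open>primitive_word\<close> to the notions of primitive cycles, which exclude only roots of the same kind.
\<close>

lemma primitive_chains_alt: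
  "primitive_chains R = {c \<in> closed_chains R. \<not> (\<exists>b m. b \<in> closed_chains R \<and> m \<ge> 2 \<and> c = seq_power b m)}"
proof -
  have "primitive_word c \<longleftrightarrow> \<not> (\<exists>b m. b \<in> closed_chains R \<and> m \<ge> 2 \<and> c = seq_power b m)"
    if c: "c \<in> closed_chains R" for c
  proof -
    have "b \<in> closed_chains R" if "m \<ge> 2" "c = seq_power b m" for b m
      using c that by (simp add: seq_power_closed_chains_iff)
    moreover have "c \<noteq> []"
      using c by (simp add: closed_chains_def)
    ultimately show ?thesis
      unfolding primitive_word_def by blast
  qed
  then show ?thesis
    unfolding primitive_chains_def by blast
qed

definition necklaces :: "('a \<Rightarrow> 'a \<Rightarrow> bool) \<Rightarrow> 'a list set set" where
  "necklaces R = primitive_chains R // cyclic_perm_rel (primitive_chains R)"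

lemma necklaces_eq: "necklaces R = rotation_class ` primitive_chains R"
proof -
  have "cyclic_perm_rel (primitive_chains R) `` {c} = rotation_class c" if "c \<in> primitive_chains R" for c
    using that rotate_primitive_chains[OF that]
    unfolding cyclic_perm_rel_def rotation_class_def by blast
  then show ?thesis
    by (auto simp: necklaces_def quotient_def)
qed

lemma rotation_class_eq:
  assumes "d \<in> rotation_class c"
  shows "rotation_class d = rotation_class c"
proof -
  have sub: "rotation_class d \<subseteq> rotation_class c" if "d \<in> rotation_class c" for c d :: "'a list"
    using that by (auto simp: rotation_class_def rotate_rotate)
  from assms obtain n where "d = rotate n c" by (auto simp: rotation_class_def)
  then have "c \<in> rotation_class d"
    by (metis rotation_class_def rotate_inverse rangeI)
  with assms sub show ?thesis by blast
qed

lemma rotation_class_self: "c \<in> rotation_class c"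
  unfolding rotation_class_def by (rule range_eqI[of _ _ 0]) simp

lemma rotation_class_conv_lessThan:
  "c \<noteq> [] \<Longrightarrow> rotation_class c = (\<lambda>n. rotate n c) ` {..<length c}"
  by (auto simp: rotation_class_def) (metis rotate_conv_mod imageI lessThan_iff length_greater_0_conv mod_less_divisor)

lemma cycle_length_rotation_class [simp]: "cycle_length (rotation_class c) = length c"
proof -
  have "length ` rotation_class c = {length c}"
    by (auto simp: rotation_class_def image_image)
  then show ?thesis by (simp add: cycle_length_def)
qed

lemma card_rotation_class:
  assumes "primitive_word c"
  shows "finite (rotation_class c)" "card (rotation_class c) = length c"
  using assms primitive_word_rotations_distinct[OF assms]
  by (auto simp: rotation_class_conv_lessThan card_image primitive_word_def)

text \<open>
  Necklaces partition the primitive chains, in the form that is needed to regroup sums.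
\<close>

lemma bij_betw_necklaces_Sigma:
  "bij_betw snd (Sigma (necklaces R) (\<lambda>p. p)) (primitive_chains R)"
proof (rule bij_betw_imageI)
  show "inj_on snd (Sigma (necklaces R) (\<lambda>p. p))"
  proof (rule inj_onI, clarsimp simp: necklaces_eq)
    fix c d x :: "'a list" assume "x \<in> rotation_class c" "x \<in> rotation_class d"
    then show "rotation_class c = rotation_class d" by (metis rotation_class_eq)
  qed
  have "snd ` Sigma (necklaces R) (\<lambda>p. p) = \<Union> (necklaces R)"
    by force
  also have "\<dots> = primitive_chains R"
  proof (intro equalityI subsetI)
    fix c assume "c \<in> primitive_chains R"
    then show "c \<in> \<Union> (necklaces R)"
      using rotation_class_self[of c] by (auto simp: necklaces_eq)
  qed (auto simp: necklaces_eq rotation_class_def rotate_primitive_chains)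
  finally show "snd ` Sigma (necklaces R) (\<lambda>p. p) = primitive_chains R" .
qed

text \<open>
  Existence and uniqueness of the primitive root.
\<close>

lemma bij_betw_powers:
  "bij_betw (\<lambda>(b, m). seq_power b m) (primitive_chains R \<times> {1..}) (closed_chains R)"
proof (rule bij_betw_imageI)
  show "inj_on (\<lambda>(b, m). seq_power b m) (primitive_chains R \<times> {1..})"
    by (rule inj_onI) (auto simp: primitive_chains_def dest: primitive_root_unique)
  have "c \<in> (\<lambda>(b, m). seq_power b m) ` (primitive_chains R \<times> {1..})" if c: "c \<in> closed_chains R" for c
  proof -
    obtain b m where "m \<ge> 1" "primitive_word b" "c = seq_power b m"
      using primitive_root_exists[of c] c by (auto simp: closed_chains_def)
    moreover from this c have "b \<in> primitive_chains R"
      by (simp add: primitive_chains_def seq_power_closed_chains_iff)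
    ultimately show ?thesis
      by (intro image_eqI[of _ _ "(b, m)"]) simp_all
  qed
  moreover have "seq_power b m \<in> closed_chains R" if "b \<in> primitive_chains R" "m \<ge> 1" for b m
    using that by (simp add: primitive_chains_def seq_power_closed_chains_iff)
  ultimately show "(\<lambda>(b, m). seq_power b m) ` (primitive_chains R \<times> {1..}) = closed_chains R"
    by fast
qed

lemma bij_betw_necklaces:
  assumes bij: "bij_betw \<Phi> (primitive_chains R) (primitive_chains S)"
    and rot: "\<And>c n. c \<in> primitive_chains R \<Longrightarrow> \<Phi> (rotate n c) = rotate n (\<Phi> c)"
  shows "bij_betw ((`) \<Phi>) (necklaces R) (necklaces S)"
proof (rule bij_betw_imageI)
  have cls: "\<Phi> ` rotation_class c = rotation_class (\<Phi> c)" if "c \<in> primitive_chains R" for c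
    using rot[OF that] by (auto simp: rotation_class_def image_image)
  have "\<Union> (necklaces R) \<subseteq> primitive_chains R"
    by (auto simp: necklaces_eq rotation_class_def rotate_primitive_chains)
  then have "inj_on \<Phi> (\<Union> (necklaces R))"
    using bij by (auto simp: bij_betw_def intro: inj_on_subset)
  then show "inj_on ((`) \<Phi>) (necklaces R)"
    by (rule inj_on_image)
  have "(`) \<Phi> ` necklaces R = rotation_class ` \<Phi> ` primitive_chains R"
    by (simp add: necklaces_eq image_image cls)
  also have "\<dots> = necklaces S"
    using bij by (simp add: necklaces_eq bij_betw_def)
  finally show "(`) \<Phi> ` necklaces R = necklaces S" .
qed

section \<open>Sliding block codes\<close>

text \<open>
  The function \<open>F\<close> sees the periodic continuation of the word from the current position on, so a
  code may look ahead by any fixed number of letters, across the end of the word.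
\<close>

definition sliding_code :: "((nat \<Rightarrow> 'a) \<Rightarrow> 'b) \<Rightarrow> 'a list \<Rightarrow> 'b list" where
  "sliding_code F c = map (\<lambda>i. F (\<lambda>k. periodic_ext c (i + k))) [0..<length c]"

lemma length_sliding_code [simp]: "length (sliding_code F c) = length c"
  by (simp add: sliding_code_def)

lemma sliding_code_eq_Nil_iff [simp]: "sliding_code F c = [] \<longleftrightarrow> c = []"
  by (simp add: sliding_code_def)

lemma periodic_ext_sliding_code:
  assumes "c \<noteq> []"
  shows "periodic_ext (sliding_code F c) i = F (\<lambda>k. periodic_ext c (i + k))"
proof -
  have "i mod length c < length c" using assms by simp
  then have "periodic_ext (sliding_code F c) i = F (\<lambda>k. periodic_ext c (i mod length c + k))"
    by (simp add: periodic_ext_def sliding_code_def)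
  also have "(\<lambda>k. periodic_ext c (i mod length c + k)) = (\<lambda>k. periodic_ext c (i + k))"
    by (simp add: periodic_ext_def mod_add_left_eq)
  finally show ?thesis .
qed

lemma sliding_code_rotate: "sliding_code F (rotate n c) = rotate n (sliding_code F c)"
proof (cases "c = []")
  case False
  then show ?thesis
    by (intro periodic_ext_eqI) (simp_all add: periodic_ext_sliding_code periodic_ext_rotate add.assoc)
qed (simp add: sliding_code_def)

lemma sliding_code_seq_power: "sliding_code F (seq_power c m) = seq_power (sliding_code F c) m"
proof (cases "c = [] \<or> m = 0")
  case False
  then have "seq_power c m \<noteq> []"
    by (metis length_0_conv length_seq_power mult_is_0)
  with False show ?thesis
    by (intro periodic_ext_eqI) (simp_all add: periodic_ext_sliding_code periodic_ext_seq_power)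
qed (auto simp: seq_power_def sliding_code_def)

text \<open>
  If the image were a proper power, decoding it would exhibit \<open>c\<close> as a proper power.
\<close>

lemma primitive_word_sliding_code:
  assumes "sliding_code F' (sliding_code F c) = c" "primitive_word c"
  shows "primitive_word (sliding_code F c)"
  unfolding primitive_word_def
proof (intro conjI notI)
  assume "sliding_code F c = []"
  with assms(2) show False by (simp add: primitive_word_def)
next
  assume "\<exists>b m. 2 \<le> m \<and> sliding_code F c = seq_power b m"
  then obtain b m where "2 \<le> m" "sliding_code F c = seq_power b m" by blast
  then have "c = seq_power (sliding_code F' b) m"
    using assms(1) by (simp add: sliding_code_seq_power)
  with \<open>2 \<le> m\<close> assms(2) show False
    unfolding primitive_word_def by blast
qed

lemma bij_betw_necklaces_sliding_code:
  assumes FR: "\<And>c. c \<in> closed_chains R \<Longrightarrow> sliding_code F c \<in> closed_chains S"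
    and GS: "\<And>d. d \<in> closed_chains S \<Longrightarrow> sliding_code F' d \<in> closed_chains R"
    and GF: "\<And>c. c \<in> closed_chains R \<Longrightarrow> sliding_code F' (sliding_code F c) = c"
    and FG: "\<And>d. d \<in> closed_chains S \<Longrightarrow> sliding_code F (sliding_code F' d) = d"
  shows "bij_betw ((`) (sliding_code F)) (necklaces R) (necklaces S)"
proof (rule bij_betw_necklaces)
  show "bij_betw (sliding_code F) (primitive_chains R) (primitive_chains S)"
    by (rule bij_betw_byWitness[where f' = "sliding_code F'"])
       (auto simp: primitive_chains_def assms intro: primitive_word_sliding_code[OF GF]
         primitive_word_sliding_code[OF FG])
qed (rule sliding_code_rotate)

lemma cycle_length_image_sliding_code:
  "cycle_length (sliding_code F ` p) = cycle_length p"
  by (simp add: cycle_length_def image_image)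

section \<open>Euler products over necklaces\<close>

lemma has_sum_minus_Ln:
  fixes z :: complex
  assumes "norm z < 1"
  shows "((\<lambda>m. z ^ m / of_nat m) has_sum - Ln (1 - z)) {1..}"
proof -
  have "(\<lambda>m. z ^ m / of_nat m) sums - Ln (1 - z)"
    using sums_minus[OF Ln_series'[of "- z"]] assms by simp
  moreover have "summable (\<lambda>m. norm (z ^ m / of_nat m))"
  proof (rule summable_comparison_test)
    show "summable (\<lambda>m. norm z ^ m)"
      using assms by (simp add: summable_geometric)
    have "norm z ^ m / real m \<le> norm z ^ m" for m
      by (cases "m = 0") (simp_all add: divide_le_eq mult_left_le_one_le mult_le_cancel_left1)
    then show "\<exists>N. \<forall>m\<ge>N. norm (norm (z ^ m / of_nat m)) \<le> norm z ^ m"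
      by (simp add: norm_divide norm_power)
  qed
  ultimately have "((\<lambda>m. z ^ m / of_nat m) has_sum - Ln (1 - z)) UNIV"
    by (intro norm_summable_imp_has_sum)
  \<comment> \<open>The term at 0 vanishes because division by 0 gives 0.\<close>
  then show ?thesis
    by (rule has_sum_cong_neutral[THEN iffD1, rotated -1]) (auto simp: Suc_le_eq)
qed

text \<open>
  The weight \<open>1 / |c|\<close> is what makes the two regroupings fit. Summing over the powers of a primitive
  word \<open>b\<close> gives \<open>- log (1 - u\<^bsup>|b|\<^esup>) / |b|\<close>, and the \<open>|b|\<close> rotations of \<open>b\<close> cancel the denominator.
\<close>

lemma has_sum_log_necklaces:
  fixes u :: complex
  assumes u: "norm u < 1"
    and S: "((\<lambda>c. u ^ length c / of_nat (length c)) has_sum S) (closed_chains R)"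
  shows "((\<lambda>p. - Ln (1 - u ^ cycle_length p)) has_sum S) (necklaces R)"
proof -
  define L where "L b = - Ln (1 - u ^ length b) / of_nat (length b)" for b :: "'a list"
  have total: "((\<lambda>(b, m). u ^ (m * length b) / of_nat (m * length b)) has_sum S) (primitive_chains R \<times> {1..})"
    using S has_sum_reindex_bij_betw[OF bij_betw_powers, of "\<lambda>c. u ^ length c / of_nat (length c)" R S]
    by (simp add: case_prod_unfold)
  have inner: "((\<lambda>m. u ^ (m * length b) / of_nat (m * length b)) has_sum L b) {1..}"
    if "b \<in> primitive_chains R" for b
  proof -
    have "b \<noteq> []" using that by (simp add: primitive_chains_def primitive_word_def)
    then have "norm (u ^ length b) < 1"
      using u by (simp add: norm_power power_less_one_iff)
    from has_sum_cmult_left[OF has_sum_minus_Ln[OF this], of "1 / of_nat (length b)"]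
    show ?thesis by (simp add: L_def power_mult[symmetric] mult.commute)
  qed
  have "(L has_sum S) (primitive_chains R)"
    using has_sum_SigmaD[OF total, of L] inner by simp
  then have "((\<lambda>(p, b). L b) has_sum S) (Sigma (necklaces R) (\<lambda>p. p))"
    using has_sum_reindex_bij_betw[OF bij_betw_necklaces_Sigma, of L R S] by (simp add: case_prod_unfold)
  then show ?thesis
  proof (rule has_sum_SigmaD)
    fix p assume "p \<in> necklaces R"
    then obtain c where c: "primitive_word c" "p = rotation_class c"
      by (auto simp: necklaces_eq primitive_chains_def)
    have "(\<Sum>b\<in>p. L b) = (\<Sum>b\<in>p. L c)"
      using c by (intro sum.cong) (auto simp: rotation_class_def L_def)
    also have "\<dots> = - Ln (1 - u ^ cycle_length p)"
      using c card_rotation_class[OF c(1)] by (auto simp: L_def primitive_word_def)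
    finally have "(\<Sum>b\<in>p. L b) = - Ln (1 - u ^ cycle_length p)" .
    moreover have "finite p" using c card_rotation_class by auto
    ultimately show "((\<lambda>b. case (p, b) of (p, b) \<Rightarrow> L b) has_sum - Ln (1 - u ^ cycle_length p)) p"
      by (simp add: has_sum_finite_iff)
  qed
qed

lemma has_sum_sum:
  fixes f :: "'i \<Rightarrow> 'a \<Rightarrow> 'b :: topological_comm_monoid_add"
  assumes "\<And>i. i \<in> I \<Longrightarrow> (f i has_sum S i) A"
  shows "((\<lambda>x. \<Sum>i\<in>I. f i x) has_sum (\<Sum>i\<in>I. S i)) A"
  using assms
proof (induction I rule: infinite_finite_induct)
  case (insert i I)
  then show ?case by (simp add: has_sum_add)
qed simp_all

lemma exp_neg_sum_Ln:
  fixes z :: "'i \<Rightarrow> complex"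
  assumes "\<And>i. i \<in> I \<Longrightarrow> norm (z i) < 1"
  shows "exp (\<Sum>i\<in>I. - Ln (1 - z i)) = (\<Prod>i\<in>I. inverse (1 - z i))"
proof (cases "finite I")
  case True
  have "1 - z i \<noteq> 0" if "i \<in> I" for i
    using assms[OF that] by auto
  then show ?thesis
    by (simp add: exp_sum True exp_minus)
qed simp

section \<open>Eigenvalues and traces of powers of a matrix\<close>

(* The entries of a vector are written with the dollar sign of the matrix library. *)
unbundle no vec_syntax

definition mat_trace :: "'a :: comm_monoid_add mat \<Rightarrow> 'a" where
  "mat_trace A = (\<Sum>i<dim_row A. A $$ (i, i))"

lemma mat_mult_index:
  assumes "A \<in> carrier_mat m k" "B \<in> carrier_mat k n" "i < m" "j < n"
  shows "(A * B) $$ (i, j) = (\<Sum>l<k. A $$ (i, l) * B $$ (l, j))"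
  using assms by (auto simp: scalar_prod_def atLeast0LessThan intro!: sum.cong)

lemma mat_trace_comm:
  fixes A B :: "'a :: comm_semiring_0 mat"
  assumes "A \<in> carrier_mat m n" "B \<in> carrier_mat n m"
  shows "mat_trace (A * B) = mat_trace (B * A)"
proof -
  have "mat_trace (A * B) = (\<Sum>i<m. \<Sum>l<n. A $$ (i, l) * B $$ (l, i))"
    using assms by (auto simp: mat_trace_def mat_mult_index[OF assms] simp del: index_mult_mat(1))
  also have "\<dots> = (\<Sum>l<n. \<Sum>i<m. B $$ (l, i) * A $$ (i, l))"
    by (subst sum.swap) (simp add: mult.commute)
  also have "\<dots> = mat_trace (B * A)"
    using assms by (auto simp: mat_trace_def mat_mult_index[OF assms(2,1)] simp del: index_mult_mat(1))
  finally show ?thesis .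
qed

lemma upper_triangular_mult:
  fixes A B :: "'a :: comm_semiring_0 mat"
  assumes "A \<in> carrier_mat n n" "B \<in> carrier_mat n n" "upper_triangular A" "upper_triangular B"
  shows "upper_triangular (A * B)"
    and "i < n \<Longrightarrow> (A * B) $$ (i, i) = A $$ (i, i) * B $$ (i, i)"
proof -
  have A: "A $$ (i, j) = 0" if "j < i" "i < n" for i j
    using assms that by auto
  have B: "B $$ (i, j) = 0" if "j < i" "i < n" for i j
    using assms that by auto
  have "(A * B) $$ (i, j) = 0" if "j < i" "i < n" for i j
  proof -
    have "(\<Sum>l<n. A $$ (i, l) * B $$ (l, j)) = 0"
    proof (intro sum.neutral ballI)
      fix l assume "l \<in> {..<n}"
      then show "A $$ (i, l) * B $$ (l, j) = 0"
        using A[of l i] B[of j l] that by (cases "l < i") auto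
    qed
    then show ?thesis using that by (simp add: mat_mult_index[OF assms(1,2)] del: index_mult_mat(1))
  qed
  then show "upper_triangular (A * B)"
    using assms by (auto intro!: upper_triangularI)
  show "(A * B) $$ (i, i) = A $$ (i, i) * B $$ (i, i)" if i: "i < n"
  proof -
    have "A $$ (i, l) * B $$ (l, i) = (if l = i then A $$ (i, i) * B $$ (i, i) else 0)" if "l < n" for l
      using A[of l i] B[of i l] that i by (cases l i rule: linorder_cases) auto
    then have "(\<Sum>l<n. A $$ (i, l) * B $$ (l, i)) =
               (\<Sum>l<n. if l = i then A $$ (i, i) * B $$ (i, i) else 0)"
      by (intro sum.cong) auto
    then show ?thesis
      using i by (simp add: mat_mult_index[OF assms(1,2)] del: index_mult_mat(1))
  qed
qed

lemma upper_triangular_pow: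
  fixes A :: "'a :: comm_semiring_1 mat"
  assumes "A \<in> carrier_mat n n" "upper_triangular A"
  shows "upper_triangular (A ^\<^sub>m l) \<and> (\<forall>i<n. (A ^\<^sub>m l) $$ (i, i) = A $$ (i, i) ^ l)"
proof (induction l)
  case 0
  then show ?case using assms by simp
next
  case (Suc l)
  have "A ^\<^sub>m l \<in> carrier_mat n n" using assms by simp
  from upper_triangular_mult[OF this assms(1) _ assms(2)] Suc show ?case
    by (simp add: mult.commute)
qed

lemma similar_mat_wit_one_minus_smult:
  fixes A B :: "'a :: comm_ring_1 mat"
  assumes A: "A \<in> carrier_mat n n" and wit: "similar_mat_wit A B P Q"
  shows "similar_mat_wit (1\<^sub>m n - u \<cdot>\<^sub>m A) (1\<^sub>m n - u \<cdot>\<^sub>m B) P Q"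
proof -
  note w = similar_mat_witD2[OF A wit]
  have "P * (1\<^sub>m n - u \<cdot>\<^sub>m B) * Q = (P - u \<cdot>\<^sub>m (P * B)) * Q"
    using w by (subst mult_minus_distrib_mat[of _ n n _ n]) (simp_all add: mult_smult_distrib)
  also have "\<dots> = P * Q - u \<cdot>\<^sub>m (P * B) * Q"
    using w by (intro minus_mult_distrib_mat[of _ n n]) auto
  also have "u \<cdot>\<^sub>m (P * B) * Q = u \<cdot>\<^sub>m (P * B * Q)"
    using w by (intro mult_smult_assoc_mat[of _ n n _ n]) auto
  also have "P * Q - u \<cdot>\<^sub>m (P * B * Q) = 1\<^sub>m n - u \<cdot>\<^sub>m A"
    using w by simp
  finally show ?thesis
    using w(1,2,4-) by (intro similar_mat_witI[of _ _ n]) auto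
qed

text \<open>
  Schur triangularization: similarity preserves the traces of all powers and \<open>det (1 - u A)\<close>, and
  for a triangular matrix both can be read off the diagonal. Choosing one enumeration \<open>e\<close> of the
  eigenvalues for all \<open>l\<close> and \<open>u\<close> is what ties the traces to the determinant.
\<close>

lemma complex_mat_spectrum:
  fixes A :: "complex mat"
  assumes A: "A \<in> carrier_mat n n"
  shows "\<exists>e. (\<forall>i<n. eigenvalue A (e i)) \<and>
             (\<forall>l. mat_trace (A ^\<^sub>m l) = (\<Sum>i<n. e i ^ l)) \<and>
             (\<forall>u. Determinant.det (1\<^sub>m n - u \<cdot>\<^sub>m A) = (\<Prod>i<n. 1 - u * e i))"
proof -
  obtain es where es: "char_poly A = (\<Prod>a\<leftarrow>es. [:- a, 1:])" "length es = n"
    using char_poly_factorized[OF A] by blast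
  obtain B P Q where BPQ: "schur_decomposition A es = (B, P, Q)"
    by (cases "schur_decomposition A es") auto
  from schur_decomposition[OF A es(1) BPQ]
  have wit: "similar_mat_wit A B P Q" and ut: "upper_triangular B" and diag: "diag_mat B = es" by auto
  note w = similar_mat_witD2[OF A wit]
  define e where "e i = B $$ (i, i)" for i
  show ?thesis
  proof (intro exI[of _ e] conjI allI impI)
    fix i assume i: "i < n"
    then have "e i \<in> set es"
      using w unfolding diag[symmetric] by (auto simp: diag_mat_def e_def)
    then have "poly (char_poly A) (e i) = 0"
      by (simp add: es poly_prod_list prod_list_zero_iff image_iff)
    then show "eigenvalue A (e i)"
      by (simp add: eigenvalue_root_char_poly[OF A])
  next
    fix l
    have "mat_trace (A ^\<^sub>m l) = mat_trace (P * (B ^\<^sub>m l * Q))"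
      using w(4-) unfolding similar_mat_wit_pow_id[OF wit] by (simp add: assoc_mult_mat[of _ n n _ n _ n])
    also have "\<dots> = mat_trace (B ^\<^sub>m l * Q * P)"
      using w by (intro mat_trace_comm[of _ n n]) auto
    also have "\<dots> = mat_trace (B ^\<^sub>m l)"
      using w(2,4-) by (simp add: assoc_mult_mat[of _ n n _ n _ n])
    also have "\<dots> = (\<Sum>i<n. e i ^ l)"
      using upper_triangular_pow[OF w(5) ut, of l] w by (simp add: mat_trace_def e_def)
    finally show "mat_trace (A ^\<^sub>m l) = (\<Sum>i<n. e i ^ l)" .
  next
    fix u
    have "Determinant.det (1\<^sub>m n - u \<cdot>\<^sub>m A) = Determinant.det (1\<^sub>m n - u \<cdot>\<^sub>m B)"
      using similar_mat_wit_one_minus_smult[OF A wit] by (intro det_similar) (auto simp: similar_mat_def)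
    also have "\<dots> = prod_list (diag_mat (1\<^sub>m n - u \<cdot>\<^sub>m B))"
      using w(4-) by (intro det_upper_triangular[of _ n])
        (auto intro!: upper_triangularI simp: upper_triangularD[OF ut])
    also have "\<dots> = (\<Prod>i<n. 1 - u * e i)"
      using w(4-) by (simp add: prod_list_diag_prod atLeast0LessThan e_def)
    finally show "Determinant.det (1\<^sub>m n - u \<cdot>\<^sub>m A) = (\<Prod>i<n. 1 - u * e i)" .
  qed
qed

text \<open>
  Compare the entries of the eigenvector equation at an index where the eigenvector is largest.
\<close>

lemma eigenvalue_norm_le_row_sum:
  fixes A :: "complex mat"
  assumes A: "A \<in> carrier_mat n n" and ev: "eigenvalue A k"
    and b: "\<And>i. i < n \<Longrightarrow> (\<Sum>j<n. norm (A $$ (i, j))) \<le> b"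
  shows "norm k \<le> b"
proof -
  from ev A obtain v where v: "v \<in> carrier_vec n" "v \<noteq> 0\<^sub>v n" "A *\<^sub>v v = k \<cdot>\<^sub>v v"
    by (auto simp: eigenvalue_def eigenvector_def)
  have "v = 0\<^sub>v n" if "\<And>i. i < n \<Longrightarrow> v $ i = 0"
    using v(1) that by (intro eq_vecI) auto
  with v(2) obtain i0 where i0: "i0 < n" "v $ i0 \<noteq> 0"
    by blast
  define M where "M = Max ((\<lambda>i. norm (v $ i)) ` {..<n})"
  have "M \<in> (\<lambda>i. norm (v $ i)) ` {..<n}"
    unfolding M_def using i0 by (intro Max_in) auto
  then obtain i where i: "i < n" "norm (v $ i) = M"
    by auto
  have le_M: "norm (v $ j) \<le> M" if "j < n" for j
    unfolding M_def using that by (intro Max_ge) auto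
  have "0 < M"
    using i0(2) le_M[OF i0(1)] zero_less_norm_iff[of "v $ i0"] by linarith
  have "norm k * M = norm (k * v $ i)"
    using i by (simp add: norm_mult)
  also have "k * v $ i = (A *\<^sub>v v) $ i"
    using v i by simp
  also have "\<dots> = (\<Sum>j<n. A $$ (i, j) * v $ j)"
    using A v(1) i by (simp add: scalar_prod_def atLeast0LessThan)
  also have "norm \<dots> \<le> (\<Sum>j<n. norm (A $$ (i, j)) * M)"
    using le_M by (intro sum_norm_le) (auto simp: norm_mult intro!: mult_left_mono)
  also have "\<dots> \<le> b * M"
    using b[OF i(1)] \<open>0 < M\<close> by (simp flip: sum_distrib_right)
  finally show ?thesis
    using \<open>0 < M\<close> by simp
qed

section \<open>Closed walks in digraphs\<close>

text \<open>
  A walk is a list of arcs, so the letters of the closed chains are the arcs, not the vertices.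
\<close>

definition arc_succ :: "('a, 'b) pre_digraph \<Rightarrow> 'b \<Rightarrow> 'b \<Rightarrow> bool" where
  "arc_succ G e f \<longleftrightarrow> e \<in> arcs G \<and> f \<in> arcs G \<and> head G e = tail G f"

lemma (in pre_digraph) cas_iff_successively:
  assumes "p \<noteq> []"
  shows "cas u p v \<longleftrightarrow> tail G (hd p) = u \<and> successively (\<lambda>e f. head G e = tail G f) p \<and> head G (last p) = v"
  using assms
proof (induction p arbitrary: u)
  case (Cons e p)
  show ?case
  proof (cases "p = []")
    case False
    show ?thesis
      unfolding cas.simps Cons.IH[OF False] using False by (auto simp: successively_Cons)
  qed auto
qed simp

lemma successively_conj_set:
  assumes "p \<noteq> []"
  shows "successively R p \<and> set p \<subseteq> A \<longleftrightarrow>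
         successively (\<lambda>x y. x \<in> A \<and> y \<in> A \<and> R x y) p \<and> last p \<in> A"
  using assms
proof (induction p)
  case (Cons x p)
  show ?case
  proof (cases "p = []")
    case False
    from Cons.IH[OF this] have
      "successively R p \<and> set p \<subseteq> A \<longleftrightarrow>
       successively (\<lambda>x y. x \<in> A \<and> y \<in> A \<and> R x y) p \<and> last p \<in> A" .
    moreover have "hd p \<in> A" if "set p \<subseteq> A"
      using that False by auto
    ultimately show ?thesis
      using False by (simp add: successively_Cons) blast
  qed auto
qed simp

text \<open>
  The base vertex in the definition of a closed walk is determined by the walk, because the walk is
  not empty.
\<close>

lemma (in wf_digraph) closed_admissible_iff:
  "closed_admissible G c \<longleftrightarrow> c \<in> closed_chains (arc_succ G)"
proof (cases "c = []")
  case False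
  have "tail G (hd c) \<in> verts G" if "set c \<subseteq> arcs G"
    using that hd_in_set[OF False] by auto
  then have "closed_admissible G c \<longleftrightarrow>
        set c \<subseteq> arcs G \<and> successively (\<lambda>e f. head G e = tail G f) c \<and> head G (last c) = tail G (hd c)"
    using False unfolding closed_admissible_def awalk_def cas_iff_successively[OF False]
    by auto
  also have "\<dots> \<longleftrightarrow> c \<in> closed_chains (arc_succ G)"
    using False successively_conj_set[OF False, of "\<lambda>e f. head G e = tail G f" "arcs G"] hd_in_set[OF False]
    unfolding closed_chains_iff_successively arc_succ_def by auto
  finally show ?thesis .
qed (simp add: closed_admissible_def closed_chains_def)

lemma (in wf_digraph) admissible_prime_cycles_eq_necklaces:
  "admissible_prime_cycles G = necklaces (arc_succ G)"
  by (simp add: admissible_prime_cycles_def necklaces_def admissible_primitive_def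
        primitive_chains_alt closed_admissible_iff)

section \<open>The determinant formula for finite digraphs\<close>

lemma operator_matrix_id_minus:
  assumes "distinct xs"
  shows "operator_matrix xs (\<lambda>f x. f x - u * F f x) = 1\<^sub>m (length xs) - u \<cdot>\<^sub>m operator_matrix xs F"
  using assms by (intro eq_matI) (auto simp: operator_matrix_def nth_eq_iff_index_eq)

text \<open>
  Powers of matrices multiply by the base on the right, so walks are extended at their end.
\<close>

lemma (in wf_digraph) awalk_snoc_iff:
  "awalk u (p @ [e]) v \<longleftrightarrow> awalk u p (tail G e) \<and> e \<in> arcs G \<and> head G e = v"
proof -
  have "cas u (p @ [e]) v \<longleftrightarrow> cas u p (tail G e) \<and> head G e = v" for u
    by (induction p arbitrary: u) auto
  then show ?thesis by (auto simp: awalk_def)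
qed

abbreviation (in pre_digraph) transfer_matrix :: "'a list \<Rightarrow> complex mat" where
  "transfer_matrix xs \<equiv> operator_matrix xs (perron_frobenius G)"

lemma operator_matrix_carrier [simp]: "operator_matrix xs F \<in> carrier_mat (length xs) (length xs)"
  by (simp add: operator_matrix_def)

context fin_digraph
begin

lemma transfer_matrix_index:
  assumes "i < length xs" "j < length xs"
  shows "transfer_matrix xs $$ (i, j) = of_nat (card {e \<in> arcs G. tail G e = xs ! i \<and> head G e = xs ! j})"
proof -
  have "transfer_matrix xs $$ (i, j) = (\<Sum>e\<in>out_arcs G (xs ! i). if head G e = xs ! j then 1 else 0)"
    using assms by (simp add: operator_matrix_def perron_frobenius_def)
  also have "\<dots> = of_nat (card {e \<in> out_arcs G (xs ! i). head G e = xs ! j})"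
    by (simp add: sum.If_cases out_arcs_def Int_def)
  also have "{e \<in> out_arcs G (xs ! i). head G e = xs ! j} = {e \<in> arcs G. tail G e = xs ! i \<and> head G e = xs ! j}"
    by (auto simp: out_arcs_def)
  finally show ?thesis .
qed

lemma finite_awalks: "finite {p. awalk a p b \<and> length p = l}"
proof (rule finite_subset)
  show "{p. awalk a p b \<and> length p = l} \<subseteq> {p. set p \<subseteq> arcs G \<and> length p = l}"
    unfolding awalk_def by blast
qed (simp add: finite_lists_length_eq)

text \<open>
  Splitting off the last arc of a walk of length \<open>l + 1\<close> is the matrix product \<open>A\<^sup>l A\<close>.
\<close>

lemma transfer_matrix_power_index:
  assumes xs: "distinct xs" "set xs = verts G"
  shows "i < length xs \<Longrightarrow> j < length xs \<Longrightarrow>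
         (transfer_matrix xs ^\<^sub>m l) $$ (i, j) = of_nat (card {p. awalk (xs ! i) p (xs ! j) \<and> length p = l})"
proof (induction l arbitrary: j)
  case 0
  have "{p. awalk (xs ! i) p (xs ! j) \<and> length p = 0} = (if i = j then {[]} else {})"
  proof -
    have "xs ! i \<in> verts G"
      using 0(1) nth_mem[of i xs] unfolding xs(2) by simp
    then have "awalk (xs ! i) [] (xs ! j) \<longleftrightarrow> i = j"
      using 0 xs(1) by (simp add: awalk_Nil_iff nth_eq_iff_index_eq)
    then show ?thesis by (cases "i = j") (auto simp del: awalk_Nil_iff)
  qed
  then show ?case using 0 by (simp add: operator_matrix_def)
next
  case (Suc l)
  let ?n = "length xs" and ?A = "transfer_matrix xs"
  let ?W = "\<lambda>k. {p. awalk (xs ! i) p (xs ! k) \<and> length p = l}"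
  let ?E = "\<lambda>k. {e \<in> arcs G. tail G e = xs ! k \<and> head G e = xs ! j}"
  have bij: "bij_betw (\<lambda>(k, p, e). p @ [e]) (Sigma {..<?n} (\<lambda>k. ?W k \<times> ?E k))
          {p. awalk (xs ! i) p (xs ! j) \<and> length p = Suc l}"
  proof (rule bij_betw_imageI)
    show "inj_on (\<lambda>(k, p, e). p @ [e]) (Sigma {..<?n} (\<lambda>k. ?W k \<times> ?E k))"
    proof (rule inj_onI)
      fix x y
      assume "x \<in> Sigma {..<?n} (\<lambda>k. ?W k \<times> ?E k)" "y \<in> Sigma {..<?n} (\<lambda>k. ?W k \<times> ?E k)"
        and "(\<lambda>(k, p, e). p @ [e]) x = (\<lambda>(k, p, e). p @ [e]) y"
      moreover obtain k p e k' p' e' where "x = (k, p, e)" "y = (k', p', e')"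
        by (metis prod_cases3)
      ultimately show "x = y"
        using xs(1) nth_eq_iff_index_eq[of xs k k'] by simp
    qed
    have "q \<in> (\<lambda>(k, p, e). p @ [e]) ` (Sigma {..<?n} (\<lambda>k. ?W k \<times> ?E k))"
      if q: "awalk (xs ! i) q (xs ! j)" "length q = Suc l" for q
    proof -
      obtain p e where pe: "q = p @ [e]"
        using q(2) by (metis length_Suc_conv_rev)
      then have "tail G e \<in> set xs"
        using q xs by (simp add: awalk_snoc_iff del: awalk_append_iff)
      then obtain k where "k < ?n" "tail G e = xs ! k"
        by (metis in_set_conv_nth)
      then show ?thesis
        using q pe by (intro image_eqI[of _ _ "(k, p, e)"]) (auto simp: awalk_snoc_iff simp del: awalk_append_iff)
    qed
    then show "(\<lambda>(k, p, e). p @ [e]) ` (Sigma {..<?n} (\<lambda>k. ?W k \<times> ?E k)) =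
        {p. awalk (xs ! i) p (xs ! j) \<and> length p = Suc l}"
      by (intro equalityI subsetI) (auto simp: awalk_snoc_iff simp del: awalk_append_iff)
  qed
  have "(?A ^\<^sub>m Suc l) $$ (i, j) = (\<Sum>k<?n. (?A ^\<^sub>m l) $$ (i, k) * ?A $$ (k, j))"
    using Suc.prems by (simp add: mat_mult_index[of _ ?n ?n _ ?n] del: index_mult_mat(1))
  also have "\<dots> = (\<Sum>k<?n. of_nat (card (?W k \<times> ?E k)))"
    using Suc by (intro sum.cong) (simp_all add: transfer_matrix_index card_cartesian_product)
  also have "\<dots> = of_nat (card (Sigma {..<?n} (\<lambda>k. ?W k \<times> ?E k)))"
    using finite_awalks by (subst card_SigmaI) auto
  also have "\<dots> = of_nat (card {p. awalk (xs ! i) p (xs ! j) \<and> length p = Suc l})"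
    using bij_betw_same_card[OF bij] by simp
  finally show ?case .
qed

text \<open>
  A nonempty closed walk has exactly one base vertex. For \<open>l = 0\<close> the trace counts the vertices
  instead, which is why that case is excluded.
\<close>

lemma mat_trace_transfer_matrix_power:
  assumes xs: "distinct xs" "set xs = verts G" and l: "l \<ge> 1"
  shows "mat_trace (transfer_matrix xs ^\<^sub>m l) = of_nat (card {c \<in> closed_chains (arc_succ G). length c = l})"
proof -
  let ?W = "\<lambda>a. {c. awalk a c a \<and> length c = l}"
  have "mat_trace (transfer_matrix xs ^\<^sub>m l) = (\<Sum>i<length xs. of_nat (card (?W (xs ! i))))"
    using transfer_matrix_power_index[OF xs]
    by (simp add: mat_trace_def carrier_matD[OF operator_matrix_carrier])
  also have "\<dots> = (\<Sum>a\<in>verts G. of_nat (card (?W a)))"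
    using sum.reindex_bij_betw[OF bij_betw_nth[OF xs(1) refl xs(2)[symmetric]], of "\<lambda>a. of_nat (card (?W a))"]
    by simp
  also have "\<dots> = of_nat (card (\<Union>a\<in>verts G. ?W a))"
  proof (subst card_UN_disjoint)
    show "\<forall>a\<in>verts G. \<forall>b\<in>verts G. a \<noteq> b \<longrightarrow> ?W a \<inter> ?W b = {}"
    proof (intro ballI impI, rule ccontr)
      fix a b assume "a \<noteq> b" "?W a \<inter> ?W b \<noteq> {}"
      then obtain c where "awalk a c a" "awalk b c b" "length c = l" by auto
      with l \<open>a \<noteq> b\<close> show False by (cases c) (auto simp: awalk_Cons_iff)
    qed
  qed (simp_all add: finite_awalks)
  also have "(\<Union>a\<in>verts G. ?W a) = {c \<in> closed_chains (arc_succ G). length c = l}"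
    using l by (auto simp: closed_admissible_iff[symmetric] closed_admissible_def awalk_def)
  finally show ?thesis .
qed

text \<open>
  The sum of a row is the out-degree of a vertex. The cruder bound by the number of all arcs is
  chosen because it also bounds the growth of the number of closed walks, so that one condition on
  \<open>u\<close> serves both.
\<close>

lemma transfer_matrix_row_sum:
  assumes xs: "distinct xs" and i: "i < length xs"
  shows "(\<Sum>j<length xs. norm (transfer_matrix xs $$ (i, j))) \<le> card (arcs G)"
proof -
  let ?E = "\<lambda>j. {e \<in> arcs G. tail G e = xs ! i \<and> head G e = xs ! j}"
  have "(\<Sum>j<length xs. norm (transfer_matrix xs $$ (i, j))) = (\<Sum>j<length xs. card (?E j))"
    using i by (simp add: transfer_matrix_index)
  also have "(\<Sum>j<length xs. card (?E j)) = card (\<Union>j<length xs. ?E j)"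
    using xs by (subst card_UN_disjoint) (auto simp: nth_eq_iff_index_eq)
  also have "\<dots> \<le> card (arcs G)"
    by (intro card_mono) auto
  finally show ?thesis by simp
qed

lemma card_closed_chains_le: "card {c \<in> closed_chains (arc_succ G). length c = l} \<le> card (arcs G) ^ l"
  and finite_closed_chains_length: "finite {c \<in> closed_chains (arc_succ G). length c = l}"
proof -
  have sub: "{c \<in> closed_chains (arc_succ G). length c = l} \<subseteq> {c. set c \<subseteq> arcs G \<and> length c = l}"
    by (auto simp: closed_admissible_iff[symmetric] closed_admissible_def awalk_def)
  from card_mono[OF finite_lists_length_eq[OF finite_arcs] this]
  show "card {c \<in> closed_chains (arc_succ G). length c = l} \<le> card (arcs G) ^ l"
    by (simp add: card_lists_length_eq)
  from finite_subset[OF sub finite_lists_length_eq[OF finite_arcs]]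
  show "finite {c \<in> closed_chains (arc_succ G). length c = l}" .
qed

text \<open>
  Over \<open>N\<close> arcs there are at most \<open>N\<^sup>l\<close> closed chains of length \<open>l\<close>, so a geometric series dominates the
  sum, and grouping the chains by length is legitimate.
\<close>

lemma has_sum_closed_chains:
  fixes u :: complex
  assumes u: "norm u * card (arcs G) < 1"
  shows "\<exists>S. ((\<lambda>c. u ^ length c / of_nat (length c)) has_sum S) (closed_chains (arc_succ G)) \<and>
         ((\<lambda>l. of_nat (card {c \<in> closed_chains (arc_succ G). length c = l}) * u ^ l / of_nat l) has_sum S) {1..}"
proof -
  let ?C = "\<lambda>l. {c \<in> closed_chains (arc_succ G). length c = l}"
  let ?f = "\<lambda>c. u ^ length c / of_nat (length c)"
  have bij: "bij_betw snd (Sigma {1..} ?C) (closed_chains (arc_succ G))"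
  proof (rule bij_betw_imageI)
    show "inj_on snd (Sigma {1..} ?C)"
      by (auto simp: inj_on_def)
    have "length c \<ge> 1" if "c \<in> closed_chains (arc_succ G)" for c
      using that by (cases c) (auto simp: closed_chains_def)
    then show "snd ` Sigma {1..} ?C = closed_chains (arc_succ G)"
      by force
  qed
  have fin: "finite (?C l)" for l
    by (rule finite_closed_chains_length)
  have "(\<lambda>(l, c). norm (?f c)) summable_on Sigma {1..} ?C"
  proof (rule summable_on_SigmaI)
    fix l :: nat
    show "((\<lambda>c. case (l, c) of (l, c) \<Rightarrow> norm (?f c)) has_sum (card (?C l) * norm u ^ l / l)) (?C l)"
      using fin[of l] by (simp add: has_sum_finite_iff norm_divide norm_power)
  next
    have "(\<lambda>l. (norm u * card (arcs G)) ^ l) summable_on UNIV"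
      using u by (intro norm_summable_imp_summable_on) (simp add: summable_geometric abs_mult)
    then have "(\<lambda>l. (norm u * card (arcs G)) ^ l) summable_on {1..}"
      by (rule summable_on_subset_banach) simp
    then show "(\<lambda>l. card (?C l) * norm u ^ l / l) summable_on {1..}"
    proof (rule summable_on_comparison_test)
      fix l :: nat assume l: "l \<in> {1..}"
      have "card (?C l) * norm u ^ l / l \<le> card (?C l) * norm u ^ l"
        using l frac_le[of "card (?C l) * norm u ^ l" _ 1 "real l"] by simp
      also have "\<dots> \<le> real (card (arcs G) ^ l) * norm u ^ l"
        using card_closed_chains_le[of l] by (intro mult_right_mono of_nat_mono) auto
      also have "\<dots> = (norm u * card (arcs G)) ^ l"
        by (simp add: power_mult_distrib)
      finally show "card (?C l) * norm u ^ l / l \<le> (norm u * card (arcs G)) ^ l" .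
    qed simp
  qed auto
  then have "?f abs_summable_on closed_chains (arc_succ G)"
    using summable_on_reindex_bij_betw[OF bij, of "\<lambda>c. norm (?f c)"] by (simp add: case_prod_unfold)
  from abs_summable_summable[OF this]
  obtain S where S: "(?f has_sum S) (closed_chains (arc_succ G))"
    by (auto simp: summable_on_def)
  then have "((\<lambda>(l, c). ?f c) has_sum S) (Sigma {1..} ?C)"
    using has_sum_reindex_bij_betw[OF bij, of ?f S] by (simp add: case_prod_unfold)
  then have "((\<lambda>l. of_nat (card (?C l)) * u ^ l / of_nat l) has_sum S) {1..}"
    by (rule has_sum_SigmaD) (simp add: has_sum_finite_iff fin)
  with S show ?thesis by blast
qed

text \<open>
  The number \<open>S\<close> is a logarithm of the zeta function. It is obtained before the enumeration
  \<open>xs\<close> of the vertices is chosen, so one \<open>S\<close> serves all enumerations. For each of them the series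
  \<open>\<Sum>\<^sub>l tr(A\<^sup>l) u\<^sup>l / l\<close> has to be evaluated once by counting walks, which gives \<open>S\<close>, and once by
  eigenvalues, which gives a logarithm of \<open>1 / det (1 - u A)\<close>.
\<close>

theorem exp_log_zeta_eq_inverse_det:
  fixes u :: complex
  assumes u: "norm u < 1" "norm u * card (arcs G) < 1"
  shows "\<exists>S. ((\<lambda>p. - Ln (1 - u ^ cycle_length p)) has_sum S) (admissible_prime_cycles G) \<and>
    (\<forall>xs. distinct xs \<and> set xs = verts G \<longrightarrow>
       exp S * Determinant.det (operator_matrix xs (\<lambda>f x. f x - u * perron_frobenius G f x)) = 1)"
proof -
  obtain S where S: "((\<lambda>c. u ^ length c / of_nat (length c)) has_sum S) (closed_chains (arc_succ G))"
    and S': "((\<lambda>l. of_nat (card {c \<in> closed_chains (arc_succ G). length c = l}) * u ^ l / of_nat l) has_sum S) {1..}"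
    using has_sum_closed_chains[OF u(2)] by blast
  have "exp S * Determinant.det (operator_matrix xs (\<lambda>f x. f x - u * perron_frobenius G f x)) = 1"
    if xs: "distinct xs" "set xs = verts G" for xs
  proof -
    let ?n = "length xs" and ?A = "transfer_matrix xs"
    obtain e where e: "\<And>i. i < ?n \<Longrightarrow> eigenvalue ?A (e i)"
        "\<And>l. mat_trace (?A ^\<^sub>m l) = (\<Sum>i<?n. e i ^ l)"
        "\<And>u. Determinant.det (1\<^sub>m ?n - u \<cdot>\<^sub>m ?A) = (\<Prod>i<?n. 1 - u * e i)"
      using complex_mat_spectrum[OF operator_matrix_carrier[of xs "perron_frobenius G"]] by blast
    have small: "norm (u * e i) < 1" if "i < ?n" for i
    proof -
      have "norm (e i) \<le> card (arcs G)"
        using eigenvalue_norm_le_row_sum[OF operator_matrix_carrier e(1)[OF that]]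
          transfer_matrix_row_sum[OF xs(1)] by blast
      then have "norm u * norm (e i) \<le> norm u * card (arcs G)"
        by (intro mult_left_mono) auto
      with u(2) show ?thesis by (simp add: norm_mult)
    qed
    have "((\<lambda>l. \<Sum>i<?n. (u * e i) ^ l / of_nat l) has_sum (\<Sum>i<?n. - Ln (1 - u * e i))) {1..}"
      using small by (intro has_sum_sum has_sum_minus_Ln) simp
    also have "?this \<longleftrightarrow> ((\<lambda>l. of_nat (card {c \<in> closed_chains (arc_succ G). length c = l}) * u ^ l / of_nat l)
        has_sum (\<Sum>i<?n. - Ln (1 - u * e i))) {1..}"
    proof (rule has_sum_cong)
      fix l :: nat assume "l \<in> {1..}"
      then show "(\<Sum>i<?n. (u * e i) ^ l / of_nat l) =
        of_nat (card {c \<in> closed_chains (arc_succ G). length c = l}) * u ^ l / of_nat l"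
        using mat_trace_transfer_matrix_power[OF xs, of l]
        by (simp add: e(2) power_mult_distrib sum_divide_distrib[symmetric] sum_distrib_left[symmetric] mult.commute)
    qed
    finally have "((\<lambda>l. of_nat (card {c \<in> closed_chains (arc_succ G). length c = l}) * u ^ l / of_nat l)
        has_sum (\<Sum>i<?n. - Ln (1 - u * e i))) {1..}" .
    with S' have "S = (\<Sum>i<?n. - Ln (1 - u * e i))"
      using has_sum_unique by blast
    then have "exp S = (\<Prod>i<?n. inverse (1 - u * e i))"
      using exp_neg_sum_Ln[of "{..<?n}" "\<lambda>i. u * e i"] small by simp
    moreover have "1 - u * e i \<noteq> 0" if "i < ?n" for i
      using small[OF that] by auto
    ultimately have "exp S * (\<Prod>i<?n. 1 - u * e i) = 1"
      by (simp flip: prod.distrib)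
    then show ?thesis
      by (simp add: operator_matrix_id_minus[OF xs(1)] e(3))
  qed
  moreover have "((\<lambda>p. - Ln (1 - u ^ cycle_length p)) has_sum S) (admissible_prime_cycles G)"
    unfolding admissible_prime_cycles_eq_necklaces by (rule has_sum_log_necklaces[OF u(1) S])
  ultimately show ?thesis by blast
qed

end

section \<open>Cycles of a hypergraph as closed walks in its oriented line graph\<close>

definition path_step :: "('v, 'e) hypergraph \<Rightarrow> 'v \<times> 'e \<Rightarrow> 'v \<times> 'e \<Rightarrow> bool" where
  "path_step H = (\<lambda>(v, e) (v', e').
     v \<in> hverts H \<and> e \<in> hedges H \<and> v' \<in> ends H e \<inter> ends H e' \<and> v \<noteq> v')"

text \<open>
  Comparing the hyperedges of all cyclically consecutive entries rules out backtracking and tails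
  at once: the square of a path contains the one comparison that the path itself lacks, between its
  last and its first hyperedge.
\<close>

definition nonbacktracking_step :: "('v, 'e) hypergraph \<Rightarrow> 'v \<times> 'e \<Rightarrow> 'v \<times> 'e \<Rightarrow> bool" where
  "nonbacktracking_step H x y \<longleftrightarrow> path_step H x y \<and> snd x \<noteq> snd y"

lemma closed_path_iff: "closed_path H c \<longleftrightarrow> c \<in> closed_chains (path_step H)"
  by (simp add: closed_path_def closed_chains_iff path_step_def Let_def case_prod_unfold)

lemma not_hyperedge_backtracking_iff:
  "\<not> hyperedge_backtracking c \<longleftrightarrow> successively (\<lambda>x y. snd x \<noteq> snd y) c"
  by (auto simp: hyperedge_backtracking_def successively_conv_nth)

lemma tailless_iff:
  assumes "c \<noteq> []"
  shows "tailless c \<longleftrightarrow> c \<in> closed_chains (\<lambda>x y. snd x \<noteq> snd y)"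
  using assms
  by (auto simp: tailless_def not_hyperedge_backtracking_iff closed_chains_iff_successively
      seq_power_def numeral_2_eq_2 successively_append_iff)

lemma primitive_cycle_iff: "primitive_cycle H c \<longleftrightarrow> c \<in> primitive_chains (nonbacktracking_step H)"
proof -
  have step: "c \<in> closed_chains (nonbacktracking_step H) \<longleftrightarrow>
      closed_path H c \<and> \<not> hyperedge_backtracking c \<and> tailless c" for c
    by (cases "c = []") (auto simp: closed_path_iff tailless_iff not_hyperedge_backtracking_iff
        closed_chains_iff_successively nonbacktracking_step_def successively_conv_nth)
  have "primitive_cycle H c" if "c \<in> primitive_chains (nonbacktracking_step H)"
  proof -
    have "b \<noteq> []" if "closed_path H b" for b
      using that by (simp add: closed_path_def)
    with that show ?thesis
      unfolding primitive_cycle_def primitive_chains_def primitive_word_def by (auto simp: step)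
  qed
  moreover have "c \<in> primitive_chains (nonbacktracking_step H)" if "primitive_cycle H c"
    using that unfolding primitive_cycle_def primitive_chains_alt by (auto simp: step)
  ultimately show ?thesis by blast
qed

lemma prime_cycles_eq_necklaces: "prime_cycles H = necklaces (nonbacktracking_step H)"
  by (simp add: prime_cycles_def necklaces_def primitive_cycle_iff)

lemma fin_digraph_oriented_line_graph:
  assumes "finite_hypergraph H"
  shows "fin_digraph (oriented_line_graph H)"
proof
  have "oriented_edges H \<subseteq> hverts H \<times> hedges H \<times> hverts H"
    using assms unfolding oriented_edges_def finite_hypergraph_def is_hypergraph_def by blast
  then have fin: "finite (oriented_edges H)"
    by (rule finite_subset) (use assms in \<open>simp add: finite_hypergraph_def\<close>)
  then show "finite (verts (oriented_line_graph H))"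
    by (simp add: oriented_line_graph_def)
  have "arcs (oriented_line_graph H) \<subseteq> oriented_edges H \<times> oriented_edges H"
    by (auto simp: oriented_line_graph_def)
  then show "finite (arcs (oriented_line_graph H))"
    by (rule finite_subset) (simp add: fin)
qed (auto simp: oriented_line_graph_def)

definition traversed_edge :: "(nat \<Rightarrow> 'v \<times> 'e) \<Rightarrow> ('v, 'e) oedge" where
  "traversed_edge s = (fst (s 0), snd (s 0), fst (s 1))"

text \<open>
  Walks in the oriented line graph are lists of arcs, and an arc is a pair of consecutive oriented
  edges. The code therefore looks two entries ahead.
\<close>

definition path_to_walk :: "(nat \<Rightarrow> 'v \<times> 'e) \<Rightarrow> ('v, 'e) oedge \<times> ('v, 'e) oedge" where
  "path_to_walk s = (traversed_edge s, traversed_edge (\<lambda>k. s (Suc k)))"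

definition walk_to_path :: "(nat \<Rightarrow> ('v, 'e) oedge \<times> ('v, 'e) oedge) \<Rightarrow> 'v \<times> 'e" where
  "walk_to_path s = (origin (fst (s 0)), color (fst (s 0)))"

text \<open>
  The path with entries \<open>(v\<^sub>i, e\<^sub>i)\<close> corresponds to the walk with the arcs \<open>(a\<^sub>i, a\<^sub>i\<^sub>+\<^sub>1)\<close>, where
  \<open>a\<^sub>i = (v\<^sub>i, e\<^sub>i, v\<^sub>i\<^sub>+\<^sub>1)\<close>. The origins and colors of the \<open>a\<^sub>i\<close> give back the path, and the path
  gives back the termini, since the terminus of each \<open>a\<^sub>i\<close> is the origin of its successor.
\<close>

lemma bij_betw_prime_cycles:
  assumes H: "is_hypergraph H"
  shows "bij_betw ((`) (sliding_code path_to_walk)) (prime_cycles H)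
           (admissible_prime_cycles (oriented_line_graph H))"
proof -
  let ?L = "oriented_line_graph H"
  interpret L: wf_digraph ?L
    by standard (auto simp: oriented_line_graph_def)
  have ends: "ends H e \<subseteq> hverts H" if "e \<in> hedges H" for e
    using H that by (auto simp: is_hypergraph_def)
  have "bij_betw ((`) (sliding_code path_to_walk)) (necklaces (nonbacktracking_step H)) (necklaces (arc_succ ?L))"
  proof (rule bij_betw_necklaces_sliding_code[where F' = walk_to_path])
    fix c assume c: "c \<in> closed_chains (nonbacktracking_step H)"
    then have "c \<noteq> []" by (simp add: closed_chains_def)
    have step: "nonbacktracking_step H (periodic_ext c i) (periodic_ext c (Suc i))" for i
      using c by (simp add: closed_chains_def)
    \<comment> \<open>A path records that \<open>v\<^sub>i\<close> lies in \<open>e\<^sub>i\<close> at the step that enters \<open>v\<^sub>i\<close>, so the cyclically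
      preceding position is used.\<close>
    have here: "fst (periodic_ext c i) \<in> ends H (snd (periodic_ext c i))" for i
    proof -
      have "Suc (i + length c - 1) = i + 1 * length c"
        using \<open>c \<noteq> []\<close> by (cases c) auto
      then have "periodic_ext c (Suc (i + length c - 1)) = periodic_ext c i"
        by (simp only: periodic_ext_add_length)
      then show ?thesis
        using step[of "i + length c - 1"]
        by (simp add: nonbacktracking_step_def path_step_def case_prod_unfold)
    qed
    have edge: "traversed_edge (\<lambda>k. periodic_ext c (i + k)) \<in> oriented_edges H" for i
      using step[of i] here[of i]
      by (simp add: traversed_edge_def oriented_edges_def nonbacktracking_step_def path_step_def case_prod_unfold)
    have arc: "path_to_walk (\<lambda>k. periodic_ext c (i + k)) \<in> arcs ?L" for i
      using edge[of i] edge[of "Suc i"] step[of i]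
      by (simp add: path_to_walk_def oriented_line_graph_def traversed_edge_def color_def terminus_def origin_def
          nonbacktracking_step_def)
    moreover have "path_to_walk (\<lambda>k. periodic_ext c (Suc (i + k))) \<in> arcs ?L" for i
      using arc[of "Suc i"] by simp
    moreover have "head ?L (path_to_walk (\<lambda>k. periodic_ext c (i + k))) =
        tail ?L (path_to_walk (\<lambda>k. periodic_ext c (Suc i + k)))" for i
      by (simp add: path_to_walk_def oriented_line_graph_def)
    ultimately show "sliding_code path_to_walk c \<in> closed_chains (arc_succ ?L)"
      using \<open>c \<noteq> []\<close> by (simp add: closed_chains_def periodic_ext_sliding_code arc_succ_def)
    show "sliding_code walk_to_path (sliding_code path_to_walk c) = c"
      using \<open>c \<noteq> []\<close>
      by (intro periodic_ext_eqI)
         (simp_all add: periodic_ext_sliding_code walk_to_path_def path_to_walk_def traversed_edge_def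
            origin_def color_def)
  next
    fix d assume d: "d \<in> closed_chains (arc_succ ?L)"
    then have "d \<noteq> []" by (simp add: closed_chains_def)
    have succ: "arc_succ ?L (periodic_ext d i) (periodic_ext d (Suc i))" for i
      using d by (simp add: closed_chains_def)
    define a where "a i = fst (periodic_ext d i)" for i
    have d_eq: "periodic_ext d i = (a i, a (Suc i))" for i
      using succ[of i] by (simp add: a_def arc_succ_def oriented_line_graph_def prod_eq_iff)
    have a: "a i \<in> oriented_edges H" "color (a i) \<noteq> color (a (Suc i))" "terminus (a i) = origin (a (Suc i))" for i
      using succ[of i] by (auto simp: d_eq arc_succ_def oriented_line_graph_def)
    have "nonbacktracking_step H (origin (a i), color (a i)) (origin (a (Suc i)), color (a (Suc i)))" for i
    proof -
      obtain v e w where vew: "a i = (v, e, w)" by (cases "a i") auto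
      obtain v' e' w' where vew': "a (Suc i) = (v', e', w')" by (cases "a (Suc i)") auto
      show ?thesis
        using a[of i] a(1)[of "Suc i"] ends[of e] unfolding vew vew'
        by (auto simp: nonbacktracking_step_def path_step_def origin_def color_def terminus_def oriented_edges_def)
    qed
    then show "sliding_code walk_to_path d \<in> closed_chains (nonbacktracking_step H)"
      using \<open>d \<noteq> []\<close>
      by (simp add: closed_chains_def periodic_ext_sliding_code walk_to_path_def d_eq)
    have "(origin (a i), color (a i), origin (a (Suc i))) = a i" for i
      using a(3)[of i] by (cases "a i") (simp add: origin_def color_def terminus_def)
    then show "sliding_code path_to_walk (sliding_code walk_to_path d) = d"
      using \<open>d \<noteq> []\<close>
      by (intro periodic_ext_eqI)
         (simp_all add: periodic_ext_sliding_code walk_to_path_def path_to_walk_def traversed_edge_def d_eq)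
  qed
  then show ?thesis
    by (simp add: prime_cycles_eq_necklaces L.admissible_prime_cycles_eq_necklaces)
qed

section \<open>The zeta function of a hypergraph\<close>

text \<open>
  A finite subproduct is the exponential of a finite sum of logarithms, so convergence of the sum
  over finite sets of prime cycles carries over, and the limit is an exponential, hence not zero.
\<close>

lemma hypergraph_zeta_eq_exp:
  assumes u: "norm u < 1"
    and S: "((\<lambda>p. - Ln (1 - u ^ cycle_length p)) has_sum S) (prime_cycles H)"
  shows "zeta_converges H u" "hypergraph_zeta H u = exp S"
proof -
  have factor: "inverse (1 - u ^ cycle_length p) = exp (- Ln (1 - u ^ cycle_length p))"
    if p: "p \<in> prime_cycles H" for p
  proof -
    obtain c where "p = rotation_class c" "c \<noteq> []"
      using p by (auto simp: prime_cycles_eq_necklaces necklaces_eq primitive_chains_def primitive_word_def)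
    then have "norm (u ^ cycle_length p) < 1"
      using u by (simp add: norm_power power_less_one_iff)
    then have "1 - u ^ cycle_length p \<noteq> 0"
      by auto
    then show ?thesis by (simp add: exp_minus)
  qed
  have "((\<lambda>F. exp (\<Sum>p\<in>F. - Ln (1 - u ^ cycle_length p))) \<longlongrightarrow> exp S) (finite_subsets_at_top (prime_cycles H))"
    using S unfolding has_sum_def by (rule tendsto_exp)
  moreover have "\<forall>\<^sub>F F in finite_subsets_at_top (prime_cycles H).
      exp (\<Sum>p\<in>F. - Ln (1 - u ^ cycle_length p)) = zeta_product H u F"
  proof (rule eventually_finite_subsets_at_top_weakI)
    fix F assume F: "finite F" "F \<subseteq> prime_cycles H"
    have "zeta_product H u F = (\<Prod>p\<in>F. exp (- Ln (1 - u ^ cycle_length p)))"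
      unfolding zeta_product_def using F by (intro prod.cong factor) auto
    with F show "exp (\<Sum>p\<in>F. - Ln (1 - u ^ cycle_length p)) = zeta_product H u F"
      by (simp only: exp_sum)
  qed
  ultimately have lim: "(zeta_product H u \<longlongrightarrow> exp S) (finite_subsets_at_top (prime_cycles H))"
    by (rule Lim_transform_eventually)
  then show "zeta_converges H u"
    unfolding zeta_converges_def by (intro exI[of _ "exp S"]) simp
  from lim show "hypergraph_zeta H u = exp S"
    unfolding hypergraph_zeta_def by (intro tendsto_Lim) simp_all
qed

theorem proposition8:
  fixes H :: "('v, 'e) hypergraph"
  assumes "finite_hypergraph H"
    and "connected_hypergraph H"
  shows "(\<forall>l. \<exists>\<phi>. bij_betw \<phi>
             {p \<in> prime_cycles H. cycle_length p = l}
             {q \<in> admissible_prime_cycles (oriented_line_graph H). cycle_length q = l}) \<and>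
         (\<exists>r>0. \<forall>u::complex. norm u < r \<longrightarrow>
             zeta_converges H u \<and>
             (\<forall>xs. distinct xs \<and> set xs = verts (oriented_line_graph H) \<longrightarrow>
                (let D = Determinant.det (operator_matrix xs
                           (\<lambda>f x. f x - u * perron_frobenius (oriented_line_graph H) f x))
                 in D \<noteq> 0 \<and> hypergraph_zeta H u = inverse D)))"
proof -
  let ?L = "oriented_line_graph H" and ?\<Phi> = "(`) (sliding_code path_to_walk)"
  interpret L: fin_digraph ?L
    by (rule fin_digraph_oriented_line_graph[OF assms(1)])
  have bij: "bij_betw ?\<Phi> (prime_cycles H) (admissible_prime_cycles ?L)"
    using assms(1) by (intro bij_betw_prime_cycles) (simp add: finite_hypergraph_def)
  have "bij_betw ?\<Phi> {p \<in> prime_cycles H. cycle_length p = l}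
          {q \<in> admissible_prime_cycles ?L. cycle_length q = l}" for l
  proof (rule bij_betw_imageI)
    show "inj_on ?\<Phi> {p \<in> prime_cycles H. cycle_length p = l}"
      using bij by (auto simp: bij_betw_def intro: inj_on_subset)
    show "?\<Phi> ` {p \<in> prime_cycles H. cycle_length p = l} =
          {q \<in> admissible_prime_cycles ?L. cycle_length q = l}"
      unfolding bij_betw_imp_surj_on[OF bij, symmetric]
      by (auto simp: cycle_length_image_sliding_code)
  qed
  moreover have "\<exists>r>0. \<forall>u::complex. norm u < r \<longrightarrow>
       zeta_converges H u \<and>
       (\<forall>xs. distinct xs \<and> set xs = verts ?L \<longrightarrow>
          (let D = Determinant.det (operator_matrix xs (\<lambda>f x. f x - u * perron_frobenius ?L f x))
           in D \<noteq> 0 \<and> hypergraph_zeta H u = inverse D))"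
    \<comment> \<open>The summand 1 makes \<open>norm u < 1\<close> and keeps the radius positive if there are no arcs.\<close>
  proof (intro exI[of _ "1 / (1 + real (card (arcs ?L)))"] conjI allI impI)
    fix u :: complex
    assume "norm u < 1 / (1 + real (card (arcs ?L)))"
    then have "norm u * (1 + card (arcs ?L)) < 1"
      by (simp add: pos_less_divide_eq)
    then have u_split: "norm u + norm u * card (arcs ?L) < 1"
      by (simp add: distrib_left)
    have "norm u * card (arcs ?L) \<ge> 0"
      by simp
    with u_split have u: "norm u < 1" "norm u * card (arcs ?L) < 1"
      using norm_ge_zero[of u] by linarith+
    from L.exp_log_zeta_eq_inverse_det[OF u] obtain S where
      S: "((\<lambda>q. - Ln (1 - u ^ cycle_length q)) has_sum S) (admissible_prime_cycles ?L)" and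
      det: "\<forall>xs. distinct xs \<and> set xs = verts ?L \<longrightarrow>
        exp S * Determinant.det (operator_matrix xs (\<lambda>f x. f x - u * perron_frobenius ?L f x)) = 1"
      by (elim exE conjE)
    have "((\<lambda>p. - Ln (1 - u ^ cycle_length p)) has_sum S) (prime_cycles H)"
      using S has_sum_reindex_bij_betw[OF bij, of "\<lambda>q. - Ln (1 - u ^ cycle_length q)" S]
      by (simp add: cycle_length_image_sliding_code)
    note zeta = hypergraph_zeta_eq_exp[OF u(1) this]
    show "zeta_converges H u" by (rule zeta)
    fix xs assume xs: "distinct xs \<and> set xs = verts ?L"
    define D where "D = Determinant.det (operator_matrix xs (\<lambda>f x. f x - u * perron_frobenius ?L f x))"
    have "exp S * D = 1"
      using det xs by (simp add: D_def)
    then have "D \<noteq> 0" "inverse D = exp S"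
      using inverse_unique[of D "exp S"] by (auto simp: mult.commute)
    then have "D \<noteq> 0 \<and> hypergraph_zeta H u = inverse D"
      by (simp add: zeta(2))
    then show "let D = Determinant.det (operator_matrix xs (\<lambda>f x. f x - u * perron_frobenius ?L f x))
               in D \<noteq> 0 \<and> hypergraph_zeta H u = inverse D"
      by (simp add: D_def Let_def)
  qed simp
  ultimately show ?thesis by blast
qed

end
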